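(* Let $V,n,T,d,\mu_2,f,\mu,\varkappa$ be as in the context, together with a group $\mathcal G$, permutations $\rho_1,\dots,\rho_d$, and permutations $\varrho_\tau$ ($\tau\in\mathcal G$) satisfying all the conditions listed there, including $\nu\ge\frac12$. Then $$1+\mu\ \ge\ \frac{1-\mu_2}{50000\,d}.$$
   Context: Let $V$ be a finite set with $n=|V|\ge2$. Let $\ell^2(V)$ be the space of functions $V\to\mathbb C$ with $\langle f,g\rangle=\sum_v f(v)\overline{g(v)}$. For $S\subseteq V$, $1_S$ is its indicator function. For a permutation $\rho$ of $V$, let $P_\rho f(v)=f(\rho^{-1}v)$; also write $\rho\cdot f=P_\rho f$, so that $P_\rho 1_S=1_{\rho(S)}$. Standing conditions on $T$, $d$, $\mu_2$: - $T:\ell^2(V)\to\ell^2(V)$ is self-adjoint. - $a_{uv}:=\langle T1_v,1_u\rangle$ is a non-negative integer for all $u,v$. - $\langle T1_V,1_u\rangle=d>0$ for all $u$. - $d\mu_2$ is the second largest eigenvalue of $T$ (with multiplicity), and $\mu_2\neq 1$. Standing conditions on $f$, $\mu$, $\varkappa$: - $f:V\to\mathbb R$ is an eigenfunction of $T$ with eigenvalue $d\mu$. - $\langle f,1_V\rangle=0$. - $f$ vanishes nowhere. - $|\mathrm{supp}(f_+)|\ge|\mathrm{supp}(f_-)|$, where $f_+=\max(f,0)$ and $f_-=\max(-f,0)$. - $\mu\neq-1$ and $0<\varkappa<1$, where $\varkappa=\frac{1+\mu}{1-\mu_2}$. Group action: - $\mathcal G$ is a group acting transitively on $V$, and no subgroup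 of index two in $\mathcal G$ acts transitively on $V$. - For each $\tau\in\mathcal G$ there is a permutation $\varrho_\tau$ of $V$ such that $\langle T1_A,1_B\rangle=\langle T1_{\tau(A)},1_{\varrho_\tau(B)}\rangle$ for all subsets $A,B\subseteq V$. Decomposition of $T$: - $T=P_{\rho_1}+\dots+P_{\rho_d}$ for permutations $\rho_1,\dots,\rho_d$ of $V$. - For a permutation $\pi$ and $\mathscr V\subseteq V$, set $\Sigma_{\pi,\mathscr V}:=\frac{\langle P_\pi1_{\mathscr V},1_{\mathscr V}\rangle+\langle P_\pi1_{\mathscr V^c},1_{\mathscr V^c}\rangle}{n}$. - If $\mathcal G$ admits a subgroup of index two, $\nu$ is the largest element of $[0,1]$ such that for every index-two subgroup $H$ of $\mathcal G$ there is $1\le i_H\le d$ with $\Sigma_{\rho_{i_H},\mathscr O}\ge\nu$ for every orbit $\mathscr O$ of $H$ on $V$. - It is assumed that $\nu\ge\frac12$. *)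

theory Defs
  imports "HOL-Analysis.Analysis" "HOL-Library.Multiset" "HOL-Algebra.Group_Action"
begin

text \<open>
  The finite set \<open>V\<close> is the universe of a type \<open>'v\<close> of class \<open>finite\<close>, and
  \<open>complex ^ 'v\<close> is the space of all functions \<open>V \<rightarrow> \<complex>\<close>. The library
  inner product on this type is the real part of the one below.
\<close>

definition cinner :: "complex ^ 'v::finite \<Rightarrow> complex ^ 'v \<Rightarrow> complex"
  where "cinner f g = (\<Sum>v\<in>UNIV. f $ v * cnj (g $ v))"

definition ind :: "'v::finite set \<Rightarrow> complex ^ 'v"
  where "ind S = (\<chi> v. if v \<in> S then 1 else 0)"

definition perm_op :: "('v::finite \<Rightarrow> 'v) \<Rightarrow> complex ^ 'v \<Rightarrow> complex ^ 'v"
  where "perm_op \<rho> f = (\<chi> v. f $ (inv_into UNIV \<rho> v))"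

definition self_adjoint_op :: "(complex ^ 'v::finite \<Rightarrow> complex ^ 'v) \<Rightarrow> bool"
  where "self_adjoint_op T \<longleftrightarrow>
    Vector_Spaces.linear (*s) (*s) T \<and> (\<forall>f g. cinner (T f) g = cinner f (T g))"

definition eigenspace :: "(complex ^ 'v::finite \<Rightarrow> complex ^ 'v) \<Rightarrow> complex \<Rightarrow> (complex ^ 'v) set"
  where "eigenspace T c = {x. T x = c *s x}"

definition eigenfunction :: "(complex ^ 'v::finite \<Rightarrow> complex ^ 'v) \<Rightarrow> complex \<Rightarrow> complex ^ 'v \<Rightarrow> bool"
  where "eigenfunction T c x \<longleftrightarrow> x \<noteq> 0 \<and> T x = c *s x"

text \<open>
  The real eigenvalues in decreasing order, each repeated according to its multiplicity
  (the complex dimension of its eigenspace). For a self-adjoint operator these are all the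
  eigenvalues, and the list has length \<open>CARD('v)\<close>.
\<close>

definition eigenvalues_desc :: "(complex ^ 'v::finite \<Rightarrow> complex ^ 'v) \<Rightarrow> real list"
  where "eigenvalues_desc T =
    rev (sorted_list_of_multiset
      (\<Sum>r\<in>{r. \<exists>x. eigenfunction T (complex_of_real r) x}.
         replicate_mset (vec.dim (eigenspace T (complex_of_real r))) r))"

definition second_largest_eigenvalue :: "(complex ^ 'v::finite \<Rightarrow> complex ^ 'v) \<Rightarrow> real"
  where "second_largest_eigenvalue T = eigenvalues_desc T ! 1"

text \<open>
  The group may be infinite; as infinite sets have cardinality 0, the condition on
  \<open>card\<close> says exactly that the index is two.
\<close>

definition index_two_subgroup :: "'g set \<Rightarrow> ('g, 'm) monoid_scheme \<Rightarrow> bool"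
  where "index_two_subgroup H G \<longleftrightarrow> subgroup H G \<and> card (rcosets\<^bsub>G\<^esub> H) = 2"

text \<open>Both inner products are non-negative integers, so taking real parts loses nothing.\<close>

definition Sigma_perm :: "('v::finite \<Rightarrow> 'v) \<Rightarrow> 'v set \<Rightarrow> real"
  where "Sigma_perm \<pi> S =
    Re (cinner (perm_op \<pi> (ind S)) (ind S) + cinner (perm_op \<pi> (ind (- S))) (ind (- S)))
      / real CARD('v)"

text \<open>
  The parameters \<open>x\<close> of which the constant \<open>\<nu>\<close> is the largest one: the index
  \<open>i\<close> may depend on the subgroup \<open>H\<close>, but not on its orbit.
\<close>

definition nu_admissible ::
  "('g, 'm) monoid_scheme \<Rightarrow> ('g \<Rightarrow> 'v::finite \<Rightarrow> 'v) \<Rightarrow> nat \<Rightarrow> (nat \<Rightarrow> 'v \<Rightarrow> 'v) \<Rightarrow> real \<Rightarrow> bool"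
  where "nu_admissible G \<phi> d \<rho> x \<longleftrightarrow>
    x \<in> {0..1} \<and>
    (\<forall>H. index_two_subgroup H G \<longrightarrow>
      (\<exists>i\<in>{1..d}. \<forall>Orb\<in>orbits (G\<lparr>carrier := H\<rparr>) UNIV \<phi>. Sigma_perm (\<rho> i) Orb \<ge> x))"

end

(*
  Let W be the space of real eigenfunctions for the eigenvalue d * mu.  For x in W the function
  |x| has Rayleigh quotient at least - mu, so by the spectral gap its variance is at most
  kappa * |x|^2.  For kappa < 1/8 two orthonormal elements of W cannot both have this
  property together with their sum and difference, hence W is spanned by f.

  For tau in G the functions f o tau^-1 and f o rho'_tau^-1 are interchanged by T up to the factor
  d * mu.  Their difference has mean zero and eigenvalue - d * mu > d * mu_2, so it vanishes, and
  f o tau^-1 lies in W.  Thus f o tau = f or f o tau = - f exactly.  By transitivity |f| is constant,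
  the stabiliser H of f has index two, and {f > 0} is an orbit of H.  The condition
  nu >= 1/2 then gives an i for which at least half of the points v satisfy
  sgn f (rho_i^-1 v) = sgn f v, so d * mu * |f|^2 = <T f, f> >= - (d - 1) * |f|^2,
  that is 1 + mu >= 1/d.
*)
theory Submission
  imports Defs
begin

section \<open>The second largest eigenvalue\<close>

text \<open>Compactness gives a maximiser \<open>x\<close> of the quadratic form on the unit sphere
  of \<open>S\<close>. Its residual \<open>M *\<^sub>R x - A x\<close> must vanish, since perturbing
  \<open>x\<close> along it would otherwise break the maximality to first order.\<close>

lemma max_rayleigh_eigenvector:
  fixes A :: "'a::euclidean_space \<Rightarrow> 'a"
  assumes lin: "linear A" and sym: "\<And>x y. A x \<bullet> y = x \<bullet> A y"
    and S: "subspace S" "S \<noteq> {0}" and inv: "\<And>x. x \<in> S \<Longrightarrow> A x \<in> S"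
  obtains x M where "x \<in> S" "x \<noteq> 0" "A x = M *\<^sub>R x" "\<And>y. y \<in> S \<Longrightarrow> A y \<bullet> y \<le> M * (y \<bullet> y)"
proof -
  let ?K = "S \<inter> sphere 0 1"
  have "compact ?K"
    using S(1) by (simp add: closed_Int_compact closed_subspace)
  moreover have "?K \<noteq> {}"
  proof -
    obtain z where z: "z \<in> S" "z \<noteq> 0" using S subspace_0 by blast
    then have "(1 / norm z) *\<^sub>R z \<in> ?K"
      using S(1) by (simp add: subspace_scale)
    then show ?thesis by blast
  qed
  moreover have "continuous_on ?K (\<lambda>x. A x \<bullet> x)"
    using lin by (intro continuous_on_inner linear_continuous_on continuous_on_id)
      (simp add: linear_conv_bounded_linear)
  ultimately obtain x where x: "x \<in> ?K" and max: "\<And>y. y \<in> ?K \<Longrightarrow> A y \<bullet> y \<le> A x \<bullet> x"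
    using continuous_attains_sup[of ?K "\<lambda>x. A x \<bullet> x"] by blast
  define M where "M = A x \<bullet> x"
  have xx: "x \<bullet> x = 1" "x \<in> S" "x \<noteq> 0"
    using x by (auto simp: norm_eq_1)
  have bound: "A y \<bullet> y \<le> M * (y \<bullet> y)" if "y \<in> S" for y
  proof (cases "y = 0")
    case True
    then show ?thesis by simp
  next
    case False
    let ?u = "(1 / norm y) *\<^sub>R y"
    have "?u \<in> ?K" using that S(1) False by (simp add: subspace_scale)
    from max[OF this] have "(1 / norm y)\<^sup>2 * (A y \<bullet> y) \<le> M"
      by (simp add: linear_cmul[OF lin] M_def power2_eq_square)
    then show ?thesis
      using False by (simp add: divide_simps power2_norm_eq_inner mult.commute)
  qed
  define z where "z = M *\<^sub>R x - A x"
  have zS: "z \<in> S" using xx S(1) inv by (simp add: z_def subspace_diff subspace_scale)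
  define q where "q = M * (z \<bullet> z) - A z \<bullet> z"
  define w where "w = z \<bullet> z"
  have q: "q \<ge> 0" using bound[OF zS] by (simp add: q_def)
  \<comment> \<open>The left-hand side is the slack of \<open>bound\<close> at
    \<open>x + t *\<^sub>R z\<close>; its constant term vanishes because \<open>bound\<close> is an
    equality at \<open>x\<close>.\<close>
  have quad: "2 * t * w + t\<^sup>2 * q \<ge> 0" for t
  proof -
    let ?y = "x + t *\<^sub>R z"
    have "?y \<in> S" using xx zS S(1) by (simp add: subspace_add subspace_scale)
    from bound[OF this] have b: "A ?y \<bullet> ?y \<le> M * (?y \<bullet> ?y)" .
    have 1: "A ?y \<bullet> ?y = M + 2 * t * (A x \<bullet> z) + t\<^sup>2 * (A z \<bullet> z)"
    proof -
      have "A z \<bullet> x = A x \<bullet> z" by (metis sym inner_commute)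
      then show ?thesis
        by (simp add: linear_add[OF lin] linear_cmul[OF lin] M_def inner_add_left inner_add_right
            power2_eq_square distrib_left)
    qed
    have 2: "?y \<bullet> ?y = 1 + 2 * t * (x \<bullet> z) + t\<^sup>2 * (z \<bullet> z)"
      using xx inner_commute[of z x]
      by (simp add: inner_add_left inner_add_right power2_eq_square distrib_left)
    have 3: "w = M * (x \<bullet> z) - A x \<bullet> z"
      unfolding w_def by (subst z_def) (simp add: inner_diff_left)
    show ?thesis using b unfolding 1 2 3 q_def by (simp add: algebra_simps)
  qed
  have "w = 0"
  proof (rule ccontr)
    assume "w \<noteq> 0"
    \<comment> \<open>The choice \<open>t = - w / (q + 1)\<close> makes the quadratic negative; the
      \<open>+ 1\<close> keeps the denominator positive when \<open>q = 0\<close>.\<close>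
    have "2 * (-w / (q + 1)) * w + (-w / (q + 1))\<^sup>2 * q = - (w\<^sup>2 * (q + 2) / (q + 1)\<^sup>2)"
    proof -
      have "q + 1 \<noteq> 0" using q by simp
      then have "2 * (-w / (q + 1)) * w = - (2 * w\<^sup>2 * (q + 1) / (q + 1)\<^sup>2)"
        by (simp add: power2_eq_square)
      moreover have "(-w / (q + 1))\<^sup>2 * q = w\<^sup>2 * q / (q + 1)\<^sup>2" by (simp add: power_divide)
      ultimately show ?thesis by (simp add: algebra_simps add_divide_distrib)
    qed
    moreover have "w\<^sup>2 * (q + 2) / (q + 1)\<^sup>2 > 0"
      using q \<open>w \<noteq> 0\<close> by simp
    ultimately show False using quad[of "-w / (q + 1)"] by linarith
  qed
  then have "A x = M *\<^sub>R x" by (simp add: w_def z_def)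
  with xx bound that show thesis by blast
qed

text \<open>Two entries, counted with multiplicity, are at least \<open>s\<close>; hence so is the
  second one in decreasing order, which has index 1.\<close>

lemma sorted_rev_nth_1_ge:
  fixes xs :: "real list"
  assumes "sorted xs" "{#s, r#} \<subseteq># mset xs" "s \<le> r"
  shows "s \<le> rev xs ! 1"
proof -
  have "filter_mset (\<lambda>x. s \<le> x) {#s, r#} \<subseteq># filter_mset (\<lambda>x. s \<le> x) (mset (rev xs))"
    using assms(2) by (intro multiset_filter_mono) simp
  from size_mset_mono[OF this] have two: "2 \<le> length (filter (\<lambda>x. s \<le> x) (rev xs))"
    using assms(3) by (simp only: mset_filter[symmetric] size_mset) simp
  have "sorted_wrt (\<ge>) (rev xs)" using assms(1) by (simp add: sorted_wrt_rev)
  moreover obtain p q zs where ys: "rev xs = p # q # zs"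
    using two le_trans[OF two length_filter_le] by (cases "rev xs" rule: remdups_adj.cases) simp_all
  ultimately have zs: "\<And>z. z \<in> set zs \<Longrightarrow> z \<le> q" by simp
  show ?thesis
  proof (rule ccontr)
    assume "\<not> ?thesis"
    then have "q < s" by (simp add: ys)
    then have "filter (\<lambda>x. s \<le> x) zs = []" using zs by (fastforce simp: filter_empty_conv)
    with two \<open>q < s\<close> show False by (simp add: ys split: if_splits)
  qed
qed

section \<open>The Hermitian inner product and multiplicities of eigenvalues\<close>

lemma Re_cinner: "Re (cinner x y) = x \<bullet> y"
  by (simp add: cinner_def inner_vec_def inner_complex_def)

lemma cinner_scale_left: "cinner (c *s x) y = c * cinner x y"
  by (simp add: cinner_def sum_distrib_left mult.assoc)

lemma cinner_scale_right: "cinner x (c *s y) = cnj c * cinner x y"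
  by (simp add: cinner_def sum_distrib_left mult_ac)

lemma cinner_self_eq_0: "cinner x x = 0 \<longleftrightarrow> x = 0"
proof
  assume "cinner x x = 0"
  then have "x \<bullet> x = 0" by (simp flip: Re_cinner)
  then show "x = 0" by simp
qed (simp add: cinner_def)

lemma eigenfunctions_orthogonal:
  assumes "self_adjoint_op T" "eigenfunction T (complex_of_real r) x"
    "eigenfunction T (complex_of_real s) y" "r \<noteq> s"
  shows "cinner x y = 0"
proof -
  have "cinner (T x) y = cinner x (T y)" using assms(1) by (simp add: self_adjoint_op_def)
  then have "complex_of_real r * cinner x y = complex_of_real s * cinner x y"
    using assms(2,3) by (simp add: eigenfunction_def cinner_scale_left cinner_scale_right)
  with assms(4) show ?thesis by simp
qed

text \<open>Eigenfunctions chosen one per eigenvalue are nonzero and pairwise orthogonal. Finiteness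
  matters because the sum in \<open>eigenvalues_desc\<close> would default to the empty multiset
  over an infinite index set.\<close>

lemma finite_real_eigenvalues:
  assumes "self_adjoint_op T"
  shows "finite {r. \<exists>x. eigenfunction T (complex_of_real r) x}" (is "finite ?R")
proof -
  obtain e where e: "\<And>r. r \<in> ?R \<Longrightarrow> eigenfunction T (complex_of_real r) (e r)"
    using bchoice[of ?R "\<lambda>r x. eigenfunction T (complex_of_real r) x"] by auto
  have orth: "cinner (e r) (e s) = 0" if "r \<in> ?R" "s \<in> ?R" "r \<noteq> s" for r s
    using eigenfunctions_orthogonal[OF assms e e] that by blast
  have "pairwise orthogonal (e ` ?R)"
    unfolding pairwise_image using orth
    by (simp add: pairwise_def orthogonal_def flip: Re_cinner)
  then have "finite (e ` ?R)" by (rule pairwise_orthogonal_imp_finite)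
  moreover have "inj_on e ?R"
  proof (rule inj_onI, rule ccontr)
    fix r s assume rs: "r \<in> ?R" "s \<in> ?R" "e r = e s" "r \<noteq> s"
    then have "cinner (e r) (e r) = 0" using orth by metis
    with e[OF rs(1)] show False by (simp add: cinner_self_eq_0 eigenfunction_def)
  qed
  ultimately show ?thesis by (rule finite_imageD)
qed

text \<open>Distinct \<open>r\<close> and \<open>s\<close> each contribute an entry to the list. If
  \<open>r = s\<close>, orthogonality makes \<open>x\<close> and \<open>y\<close> independent, so
  the eigenspace has dimension at least two and the value is listed twice.\<close>

lemma second_largest_eigenvalue_ge:
  assumes sa: "self_adjoint_op T" and x: "eigenfunction T (complex_of_real r) x"
    and y: "eigenfunction T (complex_of_real s) y" and "cinner x y = 0" "s \<le> r"
  shows "s \<le> second_largest_eigenvalue T"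
proof -
  let ?R = "{r. \<exists>x. eigenfunction T (complex_of_real r) x}"
  let ?d = "\<lambda>r. vec.dim (eigenspace T (complex_of_real r))"
  let ?m = "\<Sum>r\<in>?R. replicate_mset (?d r) r"
  have cnt: "count ?m t = ?d t" if "t \<in> ?R" for t
  proof -
    have "count ?m t = (\<Sum>r\<in>?R. if r = t then ?d r else 0)"
      unfolding count_sum by (intro sum.cong) auto
    also have "\<dots> = ?d t" using that finite_real_eigenvalues[OF sa] by (simp add: sum.delta')
    finally show ?thesis .
  qed
  have pos: "1 \<le> ?d t" if "eigenfunction T (complex_of_real t) z" for t z
    using that vec.independent_card_le_dim[of "{z}" "eigenspace T (complex_of_real t)"]
    by (simp add: eigenfunction_def eigenspace_def)
  have two: "2 \<le> ?d r" if "r = s"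
  proof -
    have "x \<notin> vec.span {y}"
    proof
      assume "x \<in> vec.span {y}"
      then obtain c where "x = c *s y" by (auto simp: vec.span_singleton)
      then have "c * cinner y y = 0" using assms(4) by (simp add: cinner_scale_left)
      then have "x = 0" using \<open>x = c *s y\<close> by (auto simp: cinner_self_eq_0)
      with x show False by (simp add: eigenfunction_def)
    qed
    moreover have "y \<noteq> 0" using y by (simp add: eigenfunction_def)
    ultimately have "vec.independent {x, y}" "x \<noteq> y"
      by (auto simp: vec.independent_insert vec.span_base)
    then show ?thesis
      using vec.independent_card_le_dim[of "{x, y}" "eigenspace T (complex_of_real r)"] x y that
      by (simp add: eigenfunction_def eigenspace_def)
  qed
  have R: "r \<in> ?R" "s \<in> ?R" using x y by auto
  have "{#s, r#} \<subseteq># ?m"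
  proof (rule mset_subset_eqI)
    fix t
    show "count {#s, r#} t \<le> count ?m t"
      using cnt[OF R(1)] cnt[OF R(2)] pos[OF x] pos[OF y] two
      by (cases "t = r"; cases "t = s") auto
  qed
  then show ?thesis
    unfolding second_largest_eigenvalue_def eigenvalues_desc_def
    using assms(5) by (intro sorted_rev_nth_1_ge[where r = r]) auto
qed

section \<open>Symmetric kernels with a spectral gap\<close>

lemma add_le_sqrt_sum_squares: "p + q \<le> sqrt (2 * (p\<^sup>2 + q\<^sup>2))" for p q :: real
proof (rule real_le_rsqrt)
  show "(p + q)\<^sup>2 \<le> 2 * (p\<^sup>2 + q\<^sup>2)"
    using zero_le_power2[of "p - q"] by (simp add: power2_sum power2_diff)
qed

text \<open>This models the matrix of \<open>T\<close> over the reals, with \<open>D\<close> in the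
  role of \<open>d\<close>.\<close>

locale regular_kernel =
  fixes a :: "'v::finite \<Rightarrow> 'v \<Rightarrow> real" and D :: real
  assumes nonneg: "a u v \<ge> 0" and sym: "a u v = a v u"
    and row_sum: "(\<Sum>v\<in>UNIV. a u v) = D" and D_pos: "D > 0"
begin

definition app :: "('v \<Rightarrow> real) \<Rightarrow> 'v \<Rightarrow> real"
  where "app x u = (\<Sum>v\<in>UNIV. a u v * x v)"

definition eig :: "real \<Rightarrow> ('v \<Rightarrow> real) \<Rightarrow> bool"
  where "eig l x \<longleftrightarrow> (\<forall>u. app x u = D * l * x u)"

definition form :: "('v \<Rightarrow> real) \<Rightarrow> real"
  where "form x = (\<Sum>u\<in>UNIV. \<Sum>v\<in>UNIV. a u v * x u * x v)"

lemma form_app: "form x = (\<Sum>u\<in>UNIV. x u * app x u)"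
  by (simp add: form_def app_def sum_distrib_left mult_ac)

lemma form_eig: "eig l x \<Longrightarrow> form x = D * l * (\<Sum>u\<in>UNIV. (x u)\<^sup>2)"
  by (simp add: form_app eig_def sum_distrib_left power2_eq_square mult_ac)

lemma app_add: "app (\<lambda>v. x v + y v) u = app x u + app y u"
  and app_diff: "app (\<lambda>v. x v - y v) u = app x u - app y u"
  and app_cmult: "app (\<lambda>v. c * x v) u = c * app x u"
  by (simp_all add: app_def algebra_simps sum.distrib sum_subtractf sum_distrib_left)

lemma app_const: "app (\<lambda>v. c) u = D * c"
  by (simp add: app_def row_sum flip: sum_distrib_right)

lemma eig_add: "eig l x \<Longrightarrow> eig l y \<Longrightarrow> eig l (\<lambda>v. x v + y v)"
  and eig_diff: "eig l x \<Longrightarrow> eig l y \<Longrightarrow> eig l (\<lambda>v. x v - y v)"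
  and eig_cmult: "eig l x \<Longrightarrow> eig l (\<lambda>v. c * x v)"
  by (simp_all add: eig_def app_add app_diff app_cmult algebra_simps)

lemma sum_app: "(\<Sum>u\<in>UNIV. app x u) = D * (\<Sum>v\<in>UNIV. x v)"
proof -
  have "(\<Sum>u\<in>UNIV. app x u) = (\<Sum>v\<in>UNIV. \<Sum>u\<in>UNIV. a u v * x v)"
    unfolding app_def by (rule sum.swap)
  also have "\<dots> = (\<Sum>v\<in>UNIV. D * x v)"
    by (simp add: row_sum sym[of _ "v" for v] flip: sum_distrib_right)
  finally show ?thesis by (simp add: sum_distrib_left)
qed

text \<open>Both cross terms vanish, because \<open>app y\<close> has mean zero together with
  \<open>y\<close>.\<close>

lemma form_shift:
  assumes "(\<Sum>v\<in>UNIV. y v) = 0"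
  shows "form (\<lambda>v. c + y v) = D * real CARD('v) * c\<^sup>2 + form y"
proof -
  have "form (\<lambda>v. c + y v) = (\<Sum>u\<in>UNIV. (c + y u) * (D * c + app y u))"
    by (simp add: form_app app_add app_const)
  also have "\<dots> = (\<Sum>u\<in>UNIV. D * c\<^sup>2 + c * app y u + D * c * y u + y u * app y u)"
    by (intro sum.cong) (auto simp: algebra_simps power2_eq_square)
  also have "\<dots> = D * real CARD('v) * c\<^sup>2 + form y"
    using assms by (simp add: sum.distrib sum_app form_app flip: sum_distrib_left)
  finally show ?thesis .
qed

text \<open>Bound each \<open>2 * \<bar>x u * x v\<bar>\<close> by the sum of the squares; rows and,
  by symmetry, columns sum to \<open>D\<close>.\<close>

lemma abs_form_le: "\<bar>form x\<bar> \<le> D * (\<Sum>v\<in>UNIV. (x v)\<^sup>2)"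
proof -
  have row: "(\<Sum>u\<in>UNIV. \<Sum>v\<in>UNIV. a u v * (x u)\<^sup>2) = D * (\<Sum>v\<in>UNIV. (x v)\<^sup>2)"
    by (simp add: row_sum sum_distrib_left flip: sum_distrib_right)
  have "(\<Sum>u\<in>UNIV. \<Sum>v\<in>UNIV. a u v * (x v)\<^sup>2) = (\<Sum>v\<in>UNIV. \<Sum>u\<in>UNIV. a u v * (x v)\<^sup>2)"
    by (rule sum.swap)
  also have "\<dots> = (\<Sum>v\<in>UNIV. \<Sum>u\<in>UNIV. a v u * (x v)\<^sup>2)"
    by (intro sum.cong refl arg_cong2[where f = "(*)"] sym)
  finally have col: "(\<Sum>u\<in>UNIV. \<Sum>v\<in>UNIV. a u v * (x v)\<^sup>2) = D * (\<Sum>v\<in>UNIV. (x v)\<^sup>2)"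
    by (simp only: row)
  have "\<bar>form x\<bar> \<le> (\<Sum>u\<in>UNIV. \<Sum>v\<in>UNIV. \<bar>a u v * x u * x v\<bar>)"
    unfolding form_def by (intro order_trans[OF sum_abs] sum_mono sum_abs)
  also have "\<dots> \<le> (\<Sum>u\<in>UNIV. \<Sum>v\<in>UNIV. (a u v * (x u)\<^sup>2 + a u v * (x v)\<^sup>2) / 2)"
  proof (intro sum_mono)
    fix u v
    have "2 * \<bar>x u * x v\<bar> \<le> (x u)\<^sup>2 + (x v)\<^sup>2"
      using zero_le_power2[of "\<bar>x u\<bar> - \<bar>x v\<bar>"] by (simp add: power2_diff abs_mult)
    then have "a u v * (2 * \<bar>x u * x v\<bar>) \<le> a u v * ((x u)\<^sup>2 + (x v)\<^sup>2)"
      by (rule mult_left_mono[OF _ nonneg])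
    then show "\<bar>a u v * x u * x v\<bar> \<le> (a u v * (x u)\<^sup>2 + a u v * (x v)\<^sup>2) / 2"
      by (simp add: abs_mult abs_of_nonneg[OF nonneg] distrib_left)
  qed
  also have "\<dots> = D * (\<Sum>v\<in>UNIV. (x v)\<^sup>2)"
    by (simp add: sum.distrib row col flip: sum_divide_distrib)
  finally show ?thesis .
qed

lemma eig_ge_minus_1:
  assumes "eig l x" "(\<Sum>v\<in>UNIV. (x v)\<^sup>2) > 0"
  shows "l \<ge> -1"
proof -
  have "D * (\<Sum>v\<in>UNIV. (x v)\<^sup>2) * - l \<le> D * (\<Sum>v\<in>UNIV. (x v)\<^sup>2) * 1"
    using abs_form_le[of x] by (simp add: form_eig[OF assms(1)] mult_ac)
  moreover have "D * (\<Sum>v\<in>UNIV. (x v)\<^sup>2) > 0" using assms(2) D_pos by simp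
  ultimately have "- l \<le> 1" by (simp only: mult_le_cancel_left_pos)
  then show ?thesis by simp
qed

end

text \<open>The gap is a bound on all functions of mean zero, since it will be applied to
  \<open>\<bar>x\<bar>\<close> minus its mean, which need not be an eigenfunction. The parameter
  \<open>m\<close> stands for \<open>\<mu>2\<close>.\<close>

locale gapped_kernel = regular_kernel a D for a :: "'v::finite \<Rightarrow> 'v \<Rightarrow> real" and D +
  fixes m :: real
  assumes gap: "(\<Sum>v\<in>UNIV. x v) = 0 \<Longrightarrow> form x \<le> D * m * (\<Sum>v\<in>UNIV. (x v)\<^sup>2)"
begin

lemma eig_le_gap:
  assumes "eig l x" "(\<Sum>v\<in>UNIV. x v) = 0" "(\<Sum>v\<in>UNIV. (x v)\<^sup>2) > 0"
  shows "l \<le> m"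
proof -
  have "D * l * (\<Sum>v\<in>UNIV. (x v)\<^sup>2) \<le> D * m * (\<Sum>v\<in>UNIV. (x v)\<^sup>2)"
    using gap[OF assms(2)] form_eig[OF assms(1)] by simp
  with assms(3) D_pos show ?thesis by simp
qed

text \<open>
  Since \<open>form \<bar>x\<bar> \<ge> - form x\<close>, the function \<open>\<bar>x\<bar>\<close> has Rayleigh quotient at least
  \<open>- l\<close>; by the gap it is then close to a constant.
\<close>
lemma abs_eig_nearly_constant:
  assumes eig: "eig l x" and l: "1 + l = k * (1 - m)" "m < 1"
  obtains c y where "\<And>v. \<bar>x v\<bar> = c + y v" "c \<ge> 0" "(\<Sum>v\<in>UNIV. y v) = 0"
    "(\<Sum>v\<in>UNIV. (x v)\<^sup>2) = real CARD('v) * c\<^sup>2 + (\<Sum>v\<in>UNIV. (y v)\<^sup>2)"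
    "(\<Sum>v\<in>UNIV. (y v)\<^sup>2) \<le> k * (\<Sum>v\<in>UNIV. (x v)\<^sup>2)"
proof -
  define c where "c = (\<Sum>v\<in>UNIV. \<bar>x v\<bar>) / real CARD('v)"
  define y where "y v = \<bar>x v\<bar> - c" for v
  let ?X = "\<Sum>v\<in>UNIV. (x v)\<^sup>2" and ?Y = "\<Sum>v\<in>UNIV. (y v)\<^sup>2"
  have abs: "\<bar>x v\<bar> = c + y v" for v by (simp add: y_def)
  have sum0: "(\<Sum>v\<in>UNIV. y v) = 0" by (simp add: y_def sum_subtractf c_def)
  have "?X = (\<Sum>v\<in>UNIV. (c + y v)\<^sup>2)" by (simp flip: abs)
  also have "\<dots> = real CARD('v) * c\<^sup>2 + 2 * c * (\<Sum>v\<in>UNIV. y v) + ?Y"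
    by (simp add: power2_sum sum.distrib sum_distrib_left)
  finally have X: "?X = real CARD('v) * c\<^sup>2 + ?Y" by (simp add: sum0)
  have "- form x \<le> form (\<lambda>v. \<bar>x v\<bar>)"
    unfolding form_def sum_negf[symmetric]
  proof (intro sum_mono)
    fix u v
    have "a u v * (- (x u * x v)) \<le> a u v * (\<bar>x u\<bar> * \<bar>x v\<bar>)"
      by (intro mult_left_mono nonneg) (metis abs_ge_minus_self abs_mult)
    then show "- (a u v * x u * x v) \<le> a u v * \<bar>x u\<bar> * \<bar>x v\<bar>" by (simp add: mult.assoc)
  qed
  also have "\<dots> = D * real CARD('v) * c\<^sup>2 + form y"
    by (simp add: abs form_shift[OF sum0])
  also have "\<dots> \<le> D * real CARD('v) * c\<^sup>2 + D * m * ?Y"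
    using gap[OF sum0] by simp
  also have "\<dots> = D * (?X - (1 - m) * ?Y)" by (simp add: X algebra_simps)
  finally have "D * (- l * ?X) \<le> D * (?X - (1 - m) * ?Y)"
    by (simp add: form_eig[OF eig] mult_ac)
  then have "- l * ?X \<le> ?X - (1 - m) * ?Y" using D_pos by (simp only: mult_le_cancel_left_pos)
  then have "(1 - m) * ?Y \<le> (1 + l) * ?X" by (simp add: algebra_simps)
  then have "(1 - m) * ?Y \<le> (1 - m) * (k * ?X)" by (simp only: l(1) mult_ac)
  then have "?Y \<le> k * ?X" using l(2) by (simp only: mult_le_cancel_left_pos diff_gt_0_iff_gt)
  moreover have "c \<ge> 0" by (simp add: c_def sum_nonneg)
  ultimately show thesis using that abs sum0 X by blast
qed

text \<open>Both absolute values are constants plus mean-zero remainders of squared norm at most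
  \<open>k\<close>. The constants contribute at least \<open>1 - k\<close> to the inner product, the
  remainders at least \<open>- k\<close>.\<close>

lemma sum_abs_mult_eig_ge:
  assumes "eig l x" "eig l y" and l: "1 + l = k * (1 - m)" "m < 1" and "k \<le> 1"
    and unit: "(\<Sum>v\<in>UNIV. (x v)\<^sup>2) = 1" "(\<Sum>v\<in>UNIV. (y v)\<^sup>2) = 1"
  shows "1 - 2 * k \<le> (\<Sum>v\<in>UNIV. \<bar>x v * y v\<bar>)"
proof -
  let ?n = "real CARD('v)"
  obtain c p where p: "\<And>v. \<bar>x v\<bar> = c + p v" "c \<ge> 0" "(\<Sum>v\<in>UNIV. p v) = 0"
    "1 = ?n * c\<^sup>2 + (\<Sum>v\<in>UNIV. (p v)\<^sup>2)" "(\<Sum>v\<in>UNIV. (p v)\<^sup>2) \<le> k"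
    using abs_eig_nearly_constant[OF assms(1) l] unit(1) by auto
  obtain e q where q: "\<And>v. \<bar>y v\<bar> = e + q v" "e \<ge> 0" "(\<Sum>v\<in>UNIV. q v) = 0"
    "1 = ?n * e\<^sup>2 + (\<Sum>v\<in>UNIV. (q v)\<^sup>2)" "(\<Sum>v\<in>UNIV. (q v)\<^sup>2) \<le> k"
    using abs_eig_nearly_constant[OF assms(2) l] unit(2) by auto
  have "(1 - k)\<^sup>2 \<le> (?n * c\<^sup>2) * (?n * e\<^sup>2)"
    unfolding power2_eq_square[of "1 - k"] using p(4,5) q(4,5) \<open>k \<le> 1\<close> by (intro mult_mono) auto
  also have "(?n * c\<^sup>2) * (?n * e\<^sup>2) = (?n * c * e)\<^sup>2" by (simp add: power2_eq_square)
  finally have "(1 - k)\<^sup>2 \<le> (?n * c * e)\<^sup>2" .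
  from power2_le_imp_le[OF this] have ce: "1 - k \<le> ?n * c * e" using p(2) q(2) by simp
  \<comment> \<open>Expanding this square bounds the inner product of the remainders below by minus
    half the sum of their squared norms.\<close>
  have "0 \<le> (\<Sum>v\<in>UNIV. (p v + q v)\<^sup>2)" by (simp add: sum_nonneg)
  also have "\<dots> = (\<Sum>v\<in>UNIV. (p v)\<^sup>2) + (\<Sum>v\<in>UNIV. (q v)\<^sup>2) + 2 * (\<Sum>v\<in>UNIV. p v * q v)"
    by (simp add: power2_sum sum.distrib sum_distrib_left mult.assoc)
  finally have pq: "- k \<le> (\<Sum>v\<in>UNIV. p v * q v)" using p(5) q(5) by linarith
  have "(\<Sum>v\<in>UNIV. \<bar>x v * y v\<bar>) = (\<Sum>v\<in>UNIV. c * e + c * q v + e * p v + p v * q v)"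
    by (simp add: abs_mult p(1) q(1) distrib_left distrib_right add_ac mult.commute)
  also have "\<dots> = ?n * c * e + (\<Sum>v\<in>UNIV. p v * q v)"
    using p(3) q(3) by (simp add: sum.distrib flip: sum_distrib_left)
  finally show ?thesis using ce pq by linarith
qed

text \<open>
  Apply the previous lemma to \<open>x, y\<close> and to \<open>(x \<plusminus> y) / sqrt 2\<close>. Pointwise
  \<open>(x\<^sup>2 - y\<^sup>2)\<^sup>2 + (2 x y)\<^sup>2 = (x\<^sup>2 + y\<^sup>2)\<^sup>2\<close>, so \<open>\<bar>x\<^sup>2 - y\<^sup>2\<bar>\<close> and \<open>2 \<bar>x y\<bar>\<close> cannot both
  have the almost maximal sum 2.
\<close>
lemma no_orthonormal_eig_pair:
  assumes xy: "eig l x" "eig l y" and l: "1 + l = k * (1 - m)" "m < 1" and "k < 1 / 8"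
    and unit: "(\<Sum>v\<in>UNIV. (x v)\<^sup>2) = 1" "(\<Sum>v\<in>UNIV. (y v)\<^sup>2) = 1"
    and orth: "(\<Sum>v\<in>UNIV. x v * y v) = 0"
  shows False
proof -
  have k1: "k \<le> 1" using assms(5) by simp
  \<comment> \<open>The crude bound 3/2 matches the threshold 1/8: the lower bounds \<open>1\<close>
    and \<open>2\<close> below add up to \<open>4 - 8 * k > 3\<close>, whereas the upper bound is
    \<open>3 / 2 * 2 = 3\<close>.\<close>
  have sqrt2_le: "sqrt 2 \<le> 3 / 2" by (rule real_le_lsqrt) (simp_all add: power2_eq_square)
  define s :: real where "s = 1 / sqrt 2"
  have ss: "s * s = 1 / 2" "s\<^sup>2 = 1 / 2" by (simp_all add: s_def power2_eq_square)
  have "(\<Sum>v\<in>UNIV. (s * (x v + y v))\<^sup>2) = 1" "(\<Sum>v\<in>UNIV. (s * (x v - y v))\<^sup>2) = 1"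
    using unit orth
    by (simp_all add: power_mult_distrib ss power2_sum power2_diff sum.distrib sum_subtractf mult.assoc
        flip: sum_distrib_left sum_divide_distrib)
  from sum_abs_mult_eig_ge[OF eig_cmult[OF eig_add[OF xy]] eig_cmult[OF eig_diff[OF xy]] l k1 this]
  have "1 - 2 * k \<le> (\<Sum>v\<in>UNIV. \<bar>(s * (x v + y v)) * (s * (x v - y v))\<bar>)" .
  also have "\<dots> = (\<Sum>v\<in>UNIV. \<bar>(x v)\<^sup>2 - (y v)\<^sup>2\<bar> / 2)"
  proof (rule sum.cong)
    fix v
    have "(s * (x v + y v)) * (s * (x v - y v)) = (s * s) * ((x v)\<^sup>2 - (y v)\<^sup>2)"
      by (simp add: algebra_simps power2_eq_square)
    then show "\<bar>(s * (x v + y v)) * (s * (x v - y v))\<bar> = \<bar>(x v)\<^sup>2 - (y v)\<^sup>2\<bar> / 2"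
      by (simp add: ss)
  qed simp
  finally have 1: "2 - 4 * k \<le> (\<Sum>v\<in>UNIV. \<bar>(x v)\<^sup>2 - (y v)\<^sup>2\<bar>)"
    by (simp flip: sum_divide_distrib)
  have 2: "2 - 4 * k \<le> (\<Sum>v\<in>UNIV. 2 * \<bar>x v * y v\<bar>)"
    using sum_abs_mult_eig_ge[OF xy l k1 unit] by (simp flip: sum_distrib_left)
  have "(\<Sum>v\<in>UNIV. \<bar>(x v)\<^sup>2 - (y v)\<^sup>2\<bar> + 2 * \<bar>x v * y v\<bar>) \<le> (\<Sum>v\<in>UNIV. 3 / 2 * ((x v)\<^sup>2 + (y v)\<^sup>2))"
  proof (rule sum_mono)
    fix v
    let ?P = "\<bar>(x v)\<^sup>2 - (y v)\<^sup>2\<bar>" and ?Q = "2 * \<bar>x v * y v\<bar>" and ?R = "(x v)\<^sup>2 + (y v)\<^sup>2"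
    have "?P\<^sup>2 + ?Q\<^sup>2 = ?R\<^sup>2" by (simp add: power_mult_distrib algebra_simps power2_eq_square)
    then have "sqrt 2 * ?R = sqrt (2 * (?P\<^sup>2 + ?Q\<^sup>2))" by (simp add: real_sqrt_mult)
    moreover have "?P + ?Q \<le> sqrt (2 * (?P\<^sup>2 + ?Q\<^sup>2))" by (rule add_le_sqrt_sum_squares)
    moreover have "sqrt 2 * ?R \<le> 3 / 2 * ?R"
      using sqrt2_le by (rule mult_right_mono) simp
    ultimately show "?P + ?Q \<le> 3 / 2 * ?R" by (simp only:)
  qed
  also have "\<dots> = 3" using unit by (simp add: sum.distrib flip: sum_distrib_left sum_divide_distrib)
  finally show False using 1 2 assms(5) by (simp add: sum.distrib)
qed

text \<open>Equal norms make \<open>x + y\<close> and \<open>x - y\<close> orthogonal. If both were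
  nonzero, normalising them would give an excluded orthonormal pair.\<close>

lemma eig_unique_up_to_sign:
  assumes xy: "eig l x" "eig l y" and l: "1 + l = k * (1 - m)" "m < 1" and k: "k < 1 / 8"
    and same: "(\<Sum>v\<in>UNIV. (x v)\<^sup>2) = (\<Sum>v\<in>UNIV. (y v)\<^sup>2)"
  shows "(\<forall>v. y v = x v) \<or> (\<forall>v. y v = - x v)"
proof (rule ccontr)
  assume neg: "\<not> ?thesis"
  define z where "z v = x v + y v" for v
  define w where "w v = x v - y v" for v
  have eig: "eig l z" "eig l w" using eig_add[OF xy] eig_diff[OF xy] by (simp_all add: z_def[abs_def] w_def[abs_def])
  let ?Z = "\<Sum>v\<in>UNIV. (z v)\<^sup>2" and ?W = "\<Sum>v\<in>UNIV. (w v)\<^sup>2"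
  have Z: "?Z > 0"
  proof (rule ccontr)
    assume "\<not> ?Z > 0"
    then have "?Z = 0" by (simp add: sum_nonneg order_antisym)
    then have "\<forall>v. z v = 0" by (simp add: sum_nonneg_eq_0_iff)
    then have "\<forall>v. y v = - x v" unfolding z_def by (simp add: eq_neg_iff_add_eq_0 add.commute)
    with neg show False by blast
  qed
  have W: "?W > 0"
  proof (rule ccontr)
    assume "\<not> ?W > 0"
    then have "?W = 0" by (simp add: sum_nonneg order_antisym)
    then have "\<forall>v. w v = 0" by (simp add: sum_nonneg_eq_0_iff)
    then have "\<forall>v. y v = x v" unfolding w_def by simp
    with neg show False by blast
  qed
  have "(\<Sum>v\<in>UNIV. z v * w v) = (\<Sum>v\<in>UNIV. (x v)\<^sup>2 - (y v)\<^sup>2)"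
    by (intro sum.cong) (auto simp: z_def w_def algebra_simps power2_eq_square)
  then have zw: "(\<Sum>v\<in>UNIV. z v * w v) = 0" using same by (simp add: sum_subtractf)
  let ?s = "1 / sqrt ?Z" and ?t = "1 / sqrt ?W"
  have unit: "(\<Sum>v\<in>UNIV. (?s * z v)\<^sup>2) = 1" "(\<Sum>v\<in>UNIV. (?t * w v)\<^sup>2) = 1"
    using Z W by (simp_all add: power_divide flip: sum_divide_distrib)
  have "(\<Sum>v\<in>UNIV. (?s * z v) * (?t * w v)) = ?s * ?t * (\<Sum>v\<in>UNIV. z v * w v)"
    unfolding sum_distrib_left by (intro sum.cong) simp_all
  then have "(\<Sum>v\<in>UNIV. (?s * z v) * (?t * w v)) = 0" by (simp only: zw mult_zero_right)
  from no_orthonormal_eig_pair[OF eig_cmult[OF eig(1)] eig_cmult[OF eig(2)] l k unit this]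
  show False .
qed

text \<open>
  With \<open>g = f \<circ> \<sigma>\<inverse>\<close> and \<open>h = f \<circ> \<rho>\<inverse>\<close> the kernel interchanges \<open>g\<close> and \<open>h\<close> up to the factor
  \<open>D l\<close>, so \<open>g - h\<close> has eigenvalue \<open>- D l\<close>, which the gap excludes unless \<open>g = h\<close>.
\<close>
lemma eig_twisted_symmetry:
  assumes eig: "eig l f" and sum0: "(\<Sum>v\<in>UNIV. f v) = 0"
    and bij: "bij \<sigma>" "bij \<rho>" and twist: "\<And>u v. a (\<rho> u) (\<sigma> v) = a u v" and "- l > m"
  shows "eig l (\<lambda>v. f (inv_into UNIV \<sigma> v))"
proof -
  define g where "g v = f (inv_into UNIV \<sigma> v)" for v
  define h where "h v = f (inv_into UNIV \<rho> v)" for v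
  have g[simp]: "g (\<sigma> v) = f v" for v using bij(1) by (simp add: g_def bij_is_inj)
  have h[simp]: "h (\<rho> v) = f v" for v using bij(2) by (simp add: h_def bij_is_inj)
  \<comment> \<open>Reindexing the sum by \<open>\<sigma>\<close> turns
    \<open>a (\<rho> u) (\<sigma> v)\<close> into \<open>a u v\<close>. The computation for
    \<open>h\<close> exchanges the two indices by symmetry.\<close>
  have "app g (\<rho> u) = app f u" for u
    unfolding app_def by (subst sum.reindex_bij_betw[OF bij(1), symmetric]) (simp add: twist)
  then have Tg: "app g u = D * l * h u" for u
    using eig bij(2) unfolding eig_def by (metis bij_pointE h)
  have "app h (\<sigma> v) = app f v" for v
    unfolding app_def
    by (subst sum.reindex_bij_betw[OF bij(2), symmetric]) (simp add: sym[of "\<sigma> v"] twist sym[of _ v])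
  then have Th: "app h u = D * l * g u" for u
    using eig bij(1) unfolding eig_def by (metis bij_pointE g)
  let ?z = "\<lambda>v. g v - h v"
  have ez: "eig (- l) ?z" by (simp add: eig_def app_diff Tg Th algebra_simps)
  have "sum g UNIV = sum f UNIV" "sum h UNIV = sum f UNIV"
    using sum.reindex_bij_betw[OF bij(1), of g] sum.reindex_bij_betw[OF bij(2), of h] by simp_all
  then have "(\<Sum>v\<in>UNIV. ?z v) = 0" by (simp add: sum_subtractf)
  then have "\<not> (\<Sum>v\<in>UNIV. (?z v)\<^sup>2) > 0" using eig_le_gap[OF ez] assms(6) by force
  then have "(\<Sum>v\<in>UNIV. (?z v)\<^sup>2) = 0" by (simp add: sum_nonneg order_antisym)
  then have "g = h" by (auto simp: sum_nonneg_eq_0_iff)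
  then have "eig l g" using Tg by (simp add: eig_def)
  then show ?thesis by (simp add: g_def[abs_def])
qed

text \<open>As \<open>k < 1\<close>, the relation between \<open>l\<close> and \<open>m\<close>
  gives \<open>- l > m\<close>, so the transported function is again an eigenfunction for
  \<open>l\<close>. It has the norm of \<open>f\<close>, hence equals \<open>f\<close> or
  \<open>- f\<close>.\<close>

lemma twisted_symmetry_sign:
  assumes eig: "eig l f" and sum0: "(\<Sum>v\<in>UNIV. f v) = 0" and l: "1 + l = k * (1 - m)" "m < 1"
    and k: "k < 1 / 8" and bij: "bij \<sigma>" "bij \<rho>" and twist: "\<And>u v. a (\<rho> u) (\<sigma> v) = a u v"
  shows "(\<forall>v. f (\<sigma> v) = f v) \<or> (\<forall>v. f (\<sigma> v) = - f v)"
proof -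
  have "k * (1 - m) < 1 * (1 - m)" using k l(2) by (intro mult_strict_right_mono) auto
  then have "1 + l < 1 - m" by (simp only: l(1) mult_1)
  then have "- l > m" by linarith
  let ?g = "\<lambda>v. f (inv_into UNIV \<sigma> v)"
  have "(\<Sum>v\<in>UNIV. (f v)\<^sup>2) = (\<Sum>v\<in>UNIV. (?g v)\<^sup>2)"
    using sum.reindex_bij_betw[OF bij(1), of "\<lambda>v. (?g v)\<^sup>2"] bij(1) by (simp add: bij_is_inj)
  from eig_unique_up_to_sign[OF eig eig_twisted_symmetry[OF eig sum0 bij twist \<open>- l > m\<close>] l k this]
  have "(\<forall>v. ?g (\<sigma> v) = f (\<sigma> v)) \<or> (\<forall>v. ?g (\<sigma> v) = - f (\<sigma> v))" by blast
  then have "(\<forall>v. f v = f (\<sigma> v)) \<or> (\<forall>v. f v = - f (\<sigma> v))"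
    using bij(1) by (simp add: bij_is_inj)
  then show ?thesis by (metis minus_minus)
qed

end

section \<open>From the complex operator to its real kernel\<close>

lemma cinner_ind_singleton: "cinner x (ind {u}) = x $ u"
  by (simp add: cinner_def ind_def if_distrib[of "\<lambda>t. _ * t"] if_distrib[of cnj] cong: if_cong)

lemma linear_op_expand:
  assumes "Vector_Spaces.linear (*s) (*s) (T :: complex ^ 'v::finite \<Rightarrow> complex ^ 'v)"
  shows "T x $ u = (\<Sum>v\<in>UNIV. x $ v * T (ind {v}) $ u)"
proof -
  interpret Vector_Spaces.linear "(*s)" "(*s)" T by (rule assms)
  have "x = (\<Sum>v\<in>UNIV. x $ v *s ind {v})"
    by (simp add: vec_eq_iff ind_def if_distrib[of "\<lambda>t. _ * t"] cong: if_cong)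
  then have "T x = (\<Sum>v\<in>UNIV. x $ v *s T (ind {v}))"
    by (metis (no_types, lifting) sum scale sum.cong)
  then show ?thesis by simp
qed

context regular_kernel
begin

text \<open>The maximal Rayleigh quotient \<open>M\<close> on functions of mean zero is attained at
  an eigenvector. This is orthogonal to the constants, which have eigenvalue \<open>D\<close>, so
  \<open>M\<close> is at most the second largest eigenvalue.\<close>

lemma form_le_second_largest_eigenvalue:
  fixes T :: "complex ^ 'v \<Rightarrow> complex ^ 'v"
  assumes sa: "self_adjoint_op T" and card: "CARD('v) \<ge> 2"
    and T: "\<And>x u. T (\<chi> v. complex_of_real (x v)) $ u = complex_of_real (app x u)"
    and sum0: "(\<Sum>v\<in>UNIV. x v) = 0"
  shows "form x \<le> second_largest_eigenvalue T * (\<Sum>v\<in>UNIV. (x v)\<^sup>2)"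
proof -
  define A :: "real ^ 'v \<Rightarrow> real ^ 'v" where "A y = (\<chi> u. app (($) y) u)" for y
  define S :: "(real ^ 'v) set" where "S = {y. (\<Sum>v\<in>UNIV. y $ v) = 0}"
  have lin: "linear A"
    by (intro linearI) (simp_all add: A_def vec_eq_iff app_def distrib_left sum.distrib sum_distrib_left mult_ac)
  have symA: "A y \<bullet> z = y \<bullet> A z" for y z
  proof -
    have "A y \<bullet> z = (\<Sum>u\<in>UNIV. \<Sum>v\<in>UNIV. a u v * y $ v * z $ u)"
      by (simp add: A_def app_def inner_vec_def sum_distrib_right)
    also have "\<dots> = (\<Sum>v\<in>UNIV. \<Sum>u\<in>UNIV. a u v * y $ v * z $ u)" by (rule sum.swap)
    also have "\<dots> = (\<Sum>v\<in>UNIV. \<Sum>u\<in>UNIV. y $ v * (a v u * z $ u))"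
      by (intro sum.cong refl) (simp add: sym[of _ v for v] mult_ac)
    also have "\<dots> = y \<bullet> A z"
      by (simp add: A_def app_def inner_vec_def sum_distrib_left)
    finally show ?thesis .
  qed
  have sub: "subspace S"
    unfolding S_def by (auto simp: subspace_def sum.distrib simp flip: sum_distrib_left)
  \<comment> \<open>Two distinct points make the space of mean-zero vectors nontrivial.\<close>
  obtain i j :: 'v where ij: "i \<noteq> j"
    using card by (metis card_2_iff' card_le_Suc0_iff_eq finite numeral_2_eq_2 not_less_eq_eq UNIV_I)
  have "axis i 1 - axis j 1 \<in> S" by (simp add: S_def sum_subtractf axis_def)
  moreover have "axis i 1 - axis j 1 \<noteq> (0 :: real ^ 'v)"
    using ij by (simp add: axis_eq_axis)
  ultimately have S: "S \<noteq> {0}" by blast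
  have inv: "A y \<in> S" if "y \<in> S" for y
    using that by (simp add: S_def A_def sum_app)
  obtain y M where y: "y \<in> S" "y \<noteq> 0" "A y = M *\<^sub>R y"
    and max: "\<And>z. z \<in> S \<Longrightarrow> A z \<bullet> z \<le> M * (z \<bullet> z)"
    using max_rayleigh_eigenvector[OF lin symA sub S inv] by blast
  have form_A: "A z \<bullet> z = form (($) z)" and norm2: "z \<bullet> z = (\<Sum>v\<in>UNIV. (z $ v)\<^sup>2)" for z
    by (simp_all add: A_def form_app inner_vec_def power2_eq_square mult.commute)
  \<comment> \<open>The order \<open>M \<le> D\<close> makes \<open>M\<close> the smaller of the two
    eigenvalues to be counted.\<close>
  have "M * (y \<bullet> y) \<le> D * (y \<bullet> y)"
    using abs_form_le[of "($) y"] form_A[of y] y(3) by (simp add: norm2)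
  then have MD: "M \<le> D" using y(2) by (simp add: mult_le_cancel_right)
  let ?y = "\<chi> v. complex_of_real (y $ v)" and ?one = "\<chi> v. complex_of_real 1"
  have "app (($) y) u = M * y $ u" for u
    using y(3) by (simp add: A_def vec_eq_iff)
  then have "eigenfunction T (complex_of_real M) ?y"
    using y(2) by (simp add: eigenfunction_def vec_eq_iff T)
  moreover have "eigenfunction T (complex_of_real D) ?one"
    using T[of "\<lambda>_. 1"] by (simp add: eigenfunction_def vec_eq_iff app_const)
  moreover have "cinner ?one ?y = 0"
    using y(1) by (simp add: cinner_def S_def flip: of_real_sum)
  ultimately have M: "M \<le> second_largest_eigenvalue T"
    using second_largest_eigenvalue_ge[OF sa] MD by blast
  let ?x = "\<chi> v. x v"
  have "form x \<le> M * (\<Sum>v\<in>UNIV. (x v)\<^sup>2)"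
    using max[of ?x] sum0 by (simp add: S_def form_A norm2 vec_lambda_inverse)
  also have "\<dots> \<le> second_largest_eigenvalue T * (\<Sum>v\<in>UNIV. (x v)\<^sup>2)"
    using M by (intro mult_right_mono sum_nonneg) auto
  finally show ?thesis .
qed

end

section \<open>Transitive actions preserving a function up to sign\<close>

locale sign_action = transitive_action G UNIV \<phi>
  for G :: "('g, 'm) monoid_scheme" (structure) and \<phi> :: "'g \<Rightarrow> 'v::finite \<Rightarrow> 'v" +
  fixes f :: "'v \<Rightarrow> real"
  assumes sign: "\<tau> \<in> carrier G \<Longrightarrow> (\<forall>v. f (\<phi> \<tau> v) = f v) \<or> (\<forall>v. f (\<phi> \<tau> v) = - f v)"
    and nonzero: "f v \<noteq> 0" and mean_zero: "(\<Sum>v\<in>UNIV. f v) = 0"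
begin

definition fixer :: "'g set"
  where "fixer = {\<tau> \<in> carrier G. \<forall>v. f (\<phi> \<tau> v) = f v}"

lemma abs_const: "\<bar>f v\<bar> = \<bar>f w\<bar>"
proof -
  obtain \<tau> where "\<tau> \<in> carrier G" "\<phi> \<tau> v = w" using unique_orbit by blast
  then show ?thesis using sign[of \<tau>] by (metis abs_minus_cancel)
qed

lemma pos_neg_exist: obtains v w where "f v > 0" "f w < 0"
proof -
  have "\<exists>v. f v > 0"
  proof (rule ccontr)
    assume "\<not> ?thesis"
    then have "f v < 0" for v using nonzero[of v] by (metis linorder_neqE_linordered_idom)
    then have "(\<Sum>v\<in>UNIV. f v) < 0" by (intro sum_strict_mono[where g = "\<lambda>_. 0", simplified]) auto
    then show False using mean_zero by simp
  qed
  moreover have "\<exists>v. f v < 0"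
  proof (rule ccontr)
    assume "\<not> ?thesis"
    then have "f v > 0" for v using nonzero[of v] by (metis linorder_neqE_linordered_idom)
    then have "(\<Sum>v\<in>UNIV. f v) > 0" by (intro sum_pos) auto
    then show False using mean_zero by simp
  qed
  ultimately show thesis using that by blast
qed

lemma group_G: "group G"
  using group_hom by (simp add: group_hom_def)

lemma action_inv: "\<tau> \<in> carrier G \<Longrightarrow> \<phi> \<tau> (\<phi> (inv \<tau>) v) = v"
  using orbit_sym_aux[of "inv \<tau>" v] group.inv_closed[OF group_G] group.inv_inv[OF group_G] by simp

text \<open>Since \<open>f\<close> vanishes nowhere, \<open>f\<close> and \<open>- f\<close> differ
  at every point, and a single point decides between them.\<close>

lemma fixer_iff:
  assumes "\<tau> \<in> carrier G"
  shows "\<tau> \<in> fixer \<longleftrightarrow> f (\<phi> \<tau> v) = f v"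
  using sign[OF assms] nonzero[of v] assms unfolding fixer_def by force

lemma subgroup_fixer: "subgroup fixer G"
proof -
  interpret group G by (rule group_G)
  show ?thesis
  proof (rule subgroupI)
    show "fixer \<subseteq> carrier G" by (auto simp: fixer_def)
    have "\<phi> \<one> v = v" for v by (simp flip: id_eq_one)
    then have "\<one> \<in> fixer" by (simp add: fixer_def)
    then show "fixer \<noteq> {}" by blast
  next
    fix \<tau> assume \<tau>: "\<tau> \<in> fixer"
    then have "\<tau> \<in> carrier G" "f (\<phi> \<tau> (\<phi> (inv \<tau>) v)) = f (\<phi> (inv \<tau>) v)" for v
      by (auto simp: fixer_def)
    then show "inv \<tau> \<in> fixer" by (simp add: fixer_def action_inv)
  next
    fix \<sigma> \<tau> assume "\<sigma> \<in> fixer" "\<tau> \<in> fixer"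
    then show "\<sigma> \<otimes> \<tau> \<in> fixer" by (simp add: fixer_def composition_rule)
  qed
qed

text \<open>Both signs occur, so transitivity yields some \<open>\<sigma>\<close> that negates
  \<open>f\<close>. Two negations cancel, which places every other negating element in the coset of
  \<open>\<sigma>\<close>.\<close>

lemma index_two_fixer: "index_two_subgroup fixer G"
proof -
  interpret group G by (rule group_G)
  obtain v w where vw: "f v > 0" "f w < 0" by (rule pos_neg_exist)
  obtain \<sigma> where \<sigma>: "\<sigma> \<in> carrier G" "\<phi> \<sigma> v = w" using unique_orbit by blast
  then have neg: "f (\<phi> \<sigma> u) = - f u" for u
    using sign[OF \<sigma>(1)] vw by (metis less_asym)
  have \<sigma>_notin: "\<sigma> \<notin> fixer" using vw \<sigma> fixer_iff[OF \<sigma>(1), of v] by simp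
  have cover: "\<tau> \<in> fixer #> \<sigma>" if \<tau>: "\<tau> \<in> carrier G" "\<tau> \<notin> fixer" for \<tau>
  proof -
    let ?u = "\<phi> (inv \<sigma>) v"
    have "f v = - f ?u" using neg[of ?u] by (simp add: action_inv \<sigma>)
    moreover have "f (\<phi> \<tau> ?u) = - f ?u"
      using sign[OF \<tau>(1)] \<tau> by (auto simp: fixer_def)
    ultimately have "f (\<phi> (\<tau> \<otimes> inv \<sigma>) v) = f v"
      using \<tau>(1) \<sigma>(1) by (simp add: composition_rule)
    then have "\<tau> \<otimes> inv \<sigma> \<in> fixer" using fixer_iff[of "\<tau> \<otimes> inv \<sigma>" v] \<tau>(1) \<sigma>(1) by simp
    then show ?thesis
      using \<tau>(1) \<sigma>(1) unfolding r_coset_def by (force simp: m_assoc)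
  qed
  have "rcosets fixer = {fixer, fixer #> \<sigma>}"
  proof (intro equalityI subsetI)
    fix K assume "K \<in> rcosets fixer"
    then obtain \<tau> where \<tau>: "\<tau> \<in> carrier G" "K = fixer #> \<tau>" by (auto simp: RCOSETS_def)
    show "K \<in> {fixer, fixer #> \<sigma>}"
    proof (cases "\<tau> \<in> fixer")
      case True
      then show ?thesis using \<tau> subgroup_fixer by (simp add: coset_join2)
    next
      case False
      then show ?thesis using repr_independence[OF cover[OF \<tau>(1)] \<sigma>(1) subgroup_fixer] \<tau> by simp
    qed
  next
    fix K assume "K \<in> {fixer, fixer #> \<sigma>}"
    then show "K \<in> rcosets fixer"
      using \<sigma>(1) subgroup_fixer subgroup.subgroup_in_rcosets[OF subgroup_fixer group_G]
      by (auto simp: RCOSETS_def)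
  qed
  moreover have "fixer \<noteq> fixer #> \<sigma>"
    using rcos_self[OF \<sigma>(1) subgroup_fixer] \<sigma>_notin by blast
  ultimately show ?thesis using subgroup_fixer by (simp add: index_two_subgroup_def)
qed

text \<open>An element moving one positive point to another preserves the value there, as
  \<open>\<bar>f\<bar>\<close> is constant, and therefore fixes \<open>f\<close>.\<close>

lemma positive_part_orbit: "{v. f v > 0} \<in> orbits (G\<lparr>carrier := fixer\<rparr>) UNIV \<phi>"
proof -
  obtain v where v: "f v > 0" using pos_neg_exist by blast
  have "orbit (G\<lparr>carrier := fixer\<rparr>) \<phi> v = {w. f w > 0}"
  proof (intro equalityI subsetI)
    fix w assume "w \<in> orbit (G\<lparr>carrier := fixer\<rparr>) \<phi> v"
    then show "w \<in> {w. f w > 0}" using v by (auto simp: orbit_def fixer_def)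
  next
    fix w assume w: "w \<in> {w. f w > 0}"
    obtain \<tau> where \<tau>: "\<tau> \<in> carrier G" "\<phi> \<tau> v = w" using unique_orbit by blast
    have "f (\<phi> \<tau> v) = f v" using abs_const[of v w] v w \<tau> by simp
    then have "\<tau> \<in> fixer" using fixer_iff[OF \<tau>(1)] by blast
    then show "w \<in> orbit (G\<lparr>carrier := fixer\<rparr>) \<phi> v" using \<tau> by (auto simp: orbit_def)
  qed
  then show ?thesis by (auto simp: orbits_def)
qed

end

section \<open>Sign correlations and the final estimate\<close>

text \<open>With \<open>f\<close> equal to \<open>c\<close> or \<open>- c\<close> everywhere, each
  product is plus or minus the square of \<open>c\<close>, and \<open>Sigma_perm\<close> is the
  proportion of points whose sign agrees with that of their preimage.\<close>

lemma Sigma_perm_pos_part: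
  fixes f :: "'v::finite \<Rightarrow> real"
  assumes c: "\<And>v. \<bar>f v\<bar> = c" and nz: "\<And>v. f v \<noteq> 0"
  shows "(\<Sum>v\<in>UNIV. f v * f (inv_into UNIV \<pi> v))
    = c\<^sup>2 * real CARD('v) * (2 * Sigma_perm \<pi> {v. f v > 0} - 1)"
proof -
  let ?P = "{v. f v > 0}"
  let ?e = "\<lambda>v. if (v \<in> ?P) = (inv_into UNIV \<pi> v \<in> ?P) then 1 else 0 :: real"
  have "Re (cinner (perm_op \<pi> (ind ?P)) (ind ?P) + cinner (perm_op \<pi> (ind (- ?P))) (ind (- ?P)))
      = (\<Sum>v\<in>UNIV. ?e v)"
    unfolding cinner_def sum.distrib[symmetric] Re_sum
    by (intro sum.cong) (auto simp: perm_op_def ind_def)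
  then have Sig: "real CARD('v) * Sigma_perm \<pi> ?P = (\<Sum>v\<in>UNIV. ?e v)"
    by (simp add: Sigma_perm_def)
  have "f v * f w = c\<^sup>2 * (2 * (if (v \<in> ?P) = (w \<in> ?P) then 1 else 0) - 1)" for v w
  proof -
    have "f v = sgn (f v) * c" "f w = sgn (f w) * c" by (metis c mult_sgn_abs)+
    then have "f v * f w = (sgn (f v) * c) * (sgn (f w) * c)" by (rule arg_cong2)
    then show ?thesis using nz[of v] nz[of w] by (auto simp: sgn_real_def power2_eq_square)
  qed
  then have "(\<Sum>v\<in>UNIV. f v * f (inv_into UNIV \<pi> v)) = (\<Sum>v\<in>UNIV. c\<^sup>2 * (2 * ?e v - 1))"
    by simp
  also have "\<dots> = c\<^sup>2 * (2 * (\<Sum>v\<in>UNIV. ?e v) - real CARD('v))"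
    by (simp only: sum_distrib_left[symmetric] sum_subtractf) simp
  finally show ?thesis by (simp only: Sig[symmetric]) (simp add: algebra_simps)
qed

theorem theorem2p4:
  fixes T :: "complex ^ 'v::finite \<Rightarrow> complex ^ 'v"
    and d :: nat
    and \<mu>2 \<mu> \<kappa> \<nu> :: real
    and f :: "'v \<Rightarrow> real"
    and G :: "('g, 'm) monoid_scheme"
    and \<phi> :: "'g \<Rightarrow> 'v \<Rightarrow> 'v"
    and \<rho> :: "nat \<Rightarrow> 'v \<Rightarrow> 'v"
    and \<rho>' :: "'g \<Rightarrow> 'v \<Rightarrow> 'v"
  assumes "CARD('v) \<ge> 2"
    and "self_adjoint_op T"
    and "\<And>u v. cinner (T (ind {v})) (ind {u}) \<in> \<nat>"
    and "d > 0"
    and "\<And>u. cinner (T (ind UNIV)) (ind {u}) = of_nat d"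
    and "real d * \<mu>2 = second_largest_eigenvalue T"
    and "\<mu>2 \<noteq> 1"
    and "eigenfunction T (complex_of_real (real d * \<mu>)) (\<chi> v. complex_of_real (f v))"
    and "cinner (\<chi> v. complex_of_real (f v)) (ind UNIV) = 0"
    and "\<And>v. f v \<noteq> 0"
    and "card (support_on UNIV (\<lambda>v. max (f v) 0)) \<ge> card (support_on UNIV (\<lambda>v. max (- f v) 0))"
    and "\<mu> \<noteq> -1"
    and "\<kappa> = (1 + \<mu>) / (1 - \<mu>2)"
    and "0 < \<kappa>" and "\<kappa> < 1"
    and "group G"
    and "transitive_action G UNIV \<phi>"
    and "\<And>H. index_two_subgroup H G \<Longrightarrow> \<not> transitive_action (G\<lparr>carrier := H\<rparr>) UNIV \<phi>"
    and "\<And>\<tau>. \<tau> \<in> carrier G \<Longrightarrow> bij (\<rho>' \<tau>)"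
    and "\<And>\<tau> A B. \<tau> \<in> carrier G \<Longrightarrow>
           cinner (T (ind A)) (ind B) = cinner (T (ind (\<phi> \<tau> ` A))) (ind (\<rho>' \<tau> ` B))"
    and "\<And>i. i \<in> {1..d} \<Longrightarrow> bij (\<rho> i)"
    and "\<And>x. T x = (\<Sum>i = 1..d. perm_op (\<rho> i) x)"
    and "(\<exists>H. index_two_subgroup H G) \<Longrightarrow>
           nu_admissible G \<phi> d \<rho> \<nu> \<and> (\<forall>x. nu_admissible G \<phi> d \<rho> x \<longrightarrow> x \<le> \<nu>) \<and> \<nu> \<ge> 1 / 2"
  shows "1 + \<mu> \<ge> (1 - \<mu>2) / (50000 * real d)"
proof -
  note card = assms(1) and sa = assms(2) and d = assms(4) and nz = assms(10)
  have T_sum: "T x $ u = (\<Sum>i = 1..d. x $ inv_into UNIV (\<rho> i) u)" for x u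
    by (simp add: assms(22) perm_op_def)
  \<comment> \<open>The entries are natural numbers, so the real part is the whole entry. The first
    index is the output coordinate.\<close>
  define a where "a u v = Re (T (ind {v}) $ u)" for u v
  have Nats: "T (ind {v}) $ u \<in> \<nat>" for u v
    using assms(3)[of v u] by (simp add: cinner_ind_singleton)
  have entry: "T (ind {v}) $ u = complex_of_real (a u v)" for u v
    using Nats[of v u] by (auto simp: a_def elim!: Nats_cases)
  have linT: "Vector_Spaces.linear (*s) (*s) T" using sa by (simp add: self_adjoint_op_def)
  have T_real: "T (\<chi> v. complex_of_real (x v)) $ u = complex_of_real (\<Sum>v\<in>UNIV. a u v * x v)" for x u
    by (subst linear_op_expand[OF linT]) (simp add: entry mult.commute)
  interpret regular_kernel a "real d"
  proof
    show "a u v \<ge> 0" for u v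
      using Nats[of v u] by (auto simp: a_def elim!: Nats_cases)
    show "a u v = a v u" for u v
    proof -
      have "cinner (T (ind {v})) (ind {u}) = cinner (ind {v}) (T (ind {u}))"
        using sa by (simp add: self_adjoint_op_def)
      also have "\<dots> = cnj (T (ind {u}) $ v)"
        by (simp add: cinner_def ind_def if_distrib[of "\<lambda>t. t * _"] cong: if_cong)
      finally show ?thesis by (simp add: cinner_ind_singleton a_def)
    qed
    show "(\<Sum>v\<in>UNIV. a u v) = real d" for u
    proof -
      have "ind UNIV = (\<chi> v::'v. complex_of_real 1)" by (simp add: ind_def)
      then have "complex_of_real (\<Sum>v\<in>UNIV. a u v) = complex_of_real (real d)"
        using assms(5)[of u] T_real[of "\<lambda>_. 1" u] by (simp add: cinner_ind_singleton)
      then show ?thesis by (simp only: of_real_eq_iff)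
    qed
  qed (use d in simp)
  have T_app: "T (\<chi> v. complex_of_real (x v)) $ u = complex_of_real (app x u)" for x u
    by (simp add: T_real app_def)
  interpret gapped_kernel a "real d" \<mu>2
    by unfold_locales (use form_le_second_largest_eigenvalue[OF sa card T_app] assms(6) in simp)
  have eig: "eig \<mu> f"
    using assms(8) unfolding eigenfunction_def eig_def
    by (simp add: vec_eq_iff T_app flip: of_real_mult)
  have "complex_of_real (\<Sum>v\<in>UNIV. f v) = 0"
    using assms(9) by (simp add: cinner_def ind_def)
  then have sum0: "(\<Sum>v\<in>UNIV. f v) = 0" by (simp only: of_real_eq_0_iff)
  let ?X = "\<Sum>v\<in>UNIV. (f v)\<^sup>2"
  have X: "?X > 0" using nz by (intro sum_pos) auto
  have \<mu>: "\<mu> > -1" using eig_ge_minus_1[OF eig X] assms(12) by simp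
  have "\<mu> \<le> \<mu>2" by (rule eig_le_gap[OF eig sum0 X])
  then have le2: "1 - \<mu>2 \<le> 2" using \<mu> by simp
  \<comment> \<open>The sign of \<open>1 - \<mu>2\<close> comes from the positivity of
    \<open>\<kappa>\<close> and of \<open>1 + \<mu>\<close>.\<close>
  have gap_pos: "\<mu>2 < 1"
    using assms(13,14) \<mu> by (simp add: zero_less_divide_iff)
  then have l: "1 + \<mu> = \<kappa> * (1 - \<mu>2)" using assms(13) by simp
  have d1: "real d \<ge> 1" using d by simp
  show ?thesis
  proof (cases "\<kappa> < 1 / 8")
    \<comment> \<open>Here \<open>1 + \<mu>\<close> is at least \<open>(1 - \<mu>2) / 8\<close>,
      which already exceeds the claimed bound.\<close>
    case False
    have "(1 - \<mu>2) / (50000 * real d) \<le> (1 - \<mu>2) / 8"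
      using gap_pos d1 by (intro divide_left_mono) auto
    also have "\<dots> = 1 / 8 * (1 - \<mu>2)" by simp
    also have "\<dots> \<le> \<kappa> * (1 - \<mu>2)" using False gap_pos by (intro mult_right_mono) auto
    finally show ?thesis by (simp only: l)
  next
    case True
    interpret act: transitive_action G UNIV \<phi> by (rule assms(17))
    interpret sign_action G \<phi> f
    proof
      fix \<tau> assume \<tau>: "\<tau> \<in> carrier G"
      have "bij (\<phi> \<tau>)" using act.bij_prop0[OF \<tau>] by (simp add: Bij_def)
      \<comment> \<open>On singletons the hypothesis becomes invariance of the kernel, with
        \<open>\<rho>' \<tau>\<close> moving rows and \<open>\<phi> \<tau>\<close> moving
        columns.\<close>
      moreover have "a (\<rho>' \<tau> u) (\<phi> \<tau> v) = a u v" for u v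
        using assms(20)[OF \<tau>, of "{v}" "{u}"] by (simp add: cinner_ind_singleton a_def)
      ultimately show "(\<forall>v. f (\<phi> \<tau> v) = f v) \<or> (\<forall>v. f (\<phi> \<tau> v) = - f v)"
        using twisted_symmetry_sign[OF eig sum0 l gap_pos True] assms(19)[OF \<tau>] by blast
    qed (use nz sum0 in auto)
    \<comment> \<open>The point \<open>undefined\<close> is an arbitrary one;
      \<open>\<bar>f\<bar>\<close> takes the same value everywhere.\<close>
    let ?P = "{v. f v > 0}" and ?c = "\<bar>f undefined\<bar>"
    have c: "\<bar>f v\<bar> = ?c" for v by (rule abs_const)
    \<comment> \<open>The stabiliser of \<open>f\<close> shows that an index-two subgroup exists,
      which activates the hypothesis on \<open>\<nu>\<close>; its orbit \<open>?P\<close> then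
      supplies \<open>i\<close>.\<close>
    have "nu_admissible G \<phi> d \<rho> \<nu>" "\<nu> \<ge> 1 / 2" using assms(23) index_two_fixer by blast+
    then obtain i where i: "i \<in> {1..d}" "Sigma_perm (\<rho> i) ?P \<ge> 1 / 2"
      unfolding nu_admissible_def using index_two_fixer positive_part_orbit by (meson order_trans)
    let ?t = "\<lambda>j. \<Sum>v\<in>UNIV. f v * f (inv_into UNIV (\<rho> j) v)"
    have ti: "?t i \<ge> 0"
      using Sigma_perm_pos_part[of f ?c "\<rho> i"] c nz i(2) by simp
    have t: "?t j \<ge> - ?X" for j
    proof -
      have "- ((f v)\<^sup>2) \<le> f v * f w" for v w
      proof -
        have "\<bar>f v * f w\<bar> = (f v)\<^sup>2" by (simp add: abs_mult power2_eq_square c[of w] flip: c[of v])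
        then show ?thesis by linarith
      qed
      then show ?thesis unfolding sum_negf[symmetric] by (intro sum_mono)
    qed
    have "complex_of_real (app f u) = complex_of_real (\<Sum>j = 1..d. f (inv_into UNIV (\<rho> j) u))" for u
      by (simp add: T_sum flip: T_app)
    then have app: "app f u = (\<Sum>j = 1..d. f (inv_into UNIV (\<rho> j) u))" for u
      by (simp only: of_real_eq_iff)
    have "form f = (\<Sum>u\<in>UNIV. \<Sum>j = 1..d. f u * f (inv_into UNIV (\<rho> j) u))"
      by (simp add: form_app app sum_distrib_left)
    also have "\<dots> = (\<Sum>j = 1..d. ?t j)" by (rule sum.swap)
    \<comment> \<open>The permutation with index \<open>i\<close> contributes a non-negative term,
      and each of the other \<open>d - 1\<close> at least \<open>- ?X\<close>.\<close>
    also have "\<dots> = ?t i + (\<Sum>j \<in> {1..d} - {i}. ?t j)" using i(1) by (intro sum.remove) auto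
    also have "\<dots> \<ge> 0 + (\<Sum>j \<in> {1..d} - {i}. - ?X)" by (intro add_mono ti sum_mono t)
    finally have "(\<Sum>j \<in> {1..d} - {i}. - ?X) \<le> real d * \<mu> * ?X" by (simp only: form_eig[OF eig] add_0)
    moreover have "(\<Sum>j \<in> {1..d} - {i}. - ?X) = (1 - real d) * ?X"
      using i(1) by (simp add: of_nat_diff algebra_simps)
    ultimately have "1 - real d \<le> real d * \<mu>" using X by (simp only: mult_le_cancel_right_pos)
    then have "1 / real d \<le> 1 + \<mu>" using d1 by (simp add: field_simps)
    \<comment> \<open>As \<open>1 - \<mu>2 \<le> 2\<close>, the claimed bound is below
      \<open>1 / real d\<close>.\<close>
    moreover have "(1 - \<mu>2) / (50000 * real d) \<le> 50000 / (50000 * real d)"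
      using le2 d1 by (intro divide_right_mono) auto
    ultimately show ?thesis by simp
  qed
qed

end
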